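(* Let $k \ge 3$ be an integer and suppose there exists a $(k^2-k+2,k)$-modular Golomb ruler. Then the following hold. 1. $k \not\equiv 7 \pmod 8$. 2. If $k \equiv 2\pmod 8$, then $k-2$ is a perfect square and $k$ is the sum of two squares. 3. If $k \equiv 3$ or $6\pmod 8$, then $k-2$ is a perfect square. 4. If $k \equiv 0$ or $1\pmod 8$, then $k$ is a perfect square and the equation $(k-2)x^2 + 2y^2 = z^2$ has a nontrivial solution in integers $x$, $y$ and $z$. 5. If $k \equiv 4$ or $5\pmod 8$, then $k$ is a perfect square and the equation $(k-2)x^2 - 2y^2 = z^2$ has a nontrivial solution in integers $x$, $y$ and $z$.
   Context: For an integer $k\ge 3$ and a positive integer $v$, a $(v,k)$-modular Golomb ruler ($(v,k)$-MGR) is a set of $k$ distinct integers $0 \leq x_1 < x_2 < \cdots < x_k \leq v-1$ such that all the differences $x_j - x_i \bmod v$ (over ordered pairs $(i,j)$ with $i \neq j$) are distinct elements of $\mathbb{Z}_v$. "Square" means the square of an integer ($0$ allowed); a nontrivial solution is one with $(x,y,z)\neq(0,0,0)$. *)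

theory Defs
  imports "HOL-Number_Theory.Cong" "HOL-Computational_Algebra.Nth_Powers"
begin

text \<open>
  Elements of \<open>\<int>\<^sub>v\<close> are represented by their residues in \<open>{0..<v}\<close>, so the differences being
  distinct modulo \<open>v\<close> is injectivity of \<open>(x, y) \<mapsto> (y - x) mod v\<close> on ordered pairs of distinct
  marks. The marks are collected in a set \<open>X\<close>; their increasing enumeration carries no
  further information.
\<close>

definition modular_golomb_ruler :: "nat \<Rightarrow> nat \<Rightarrow> int set \<Rightarrow> bool" where
  "modular_golomb_ruler v k X \<longleftrightarrow>
     v > 0 \<and> k \<ge> 3 \<and> X \<subseteq> {0..<int v} \<and> card X = k \<and>
     inj_on (\<lambda>(x, y). (y - x) mod int v) {(x, y). x \<in> X \<and> y \<in> X \<and> x \<noteq> y}"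

end

theory Submission
  imports
    Defs
    "HOL-Number_Theory.Quadratic_Reciprocity"
    "HOL-Library.Discrete_Functions"
    "HOL-Computational_Algebra.Polynomial"
begin

text \<open>
  Put \<open>v = k\<^sup>2 - k + 2\<close> and \<open>n = v / 2\<close>. The \<open>k\<^sup>2 - k\<close> differences of a ruler \<open>X\<close> are distinct and nonzero and omit
  exactly one nonzero residue, which must be \<open>n\<close>. Therefore every character \<open>\<chi>\<close> of \<open>\<int>\<^sub>v\<close>, extended to the group ring,
  if nontrivial, satisfies \<open>\<bar>\<chi>(X)\<bar>\<^sup>2 = k - 1 - \<chi>(n)\<close>, which is \<open>k - 2\<close> if \<open>\<chi>(n) = 1\<close> and \<open>k\<close> if
  \<open>\<chi>(n) = -1\<close> (lemma \<open>modular_golomb_ruler_double_sum\<close>).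

  The character of order 2 shows that \<open>k - 2\<close> is a square if \<open>n\<close> is even and that \<open>k\<close> is a square if \<open>n\<close> is odd. If
  \<open>n \<equiv> 2 (mod 4)\<close>, a character of order 4 has values in the Gaussian integers and is \<open>-1\<close> at \<open>n\<close>, so \<open>k\<close> is a sum
  of two squares; this also excludes \<open>k \<equiv> 7 (mod 8)\<close>. If \<open>k = a\<^sup>2\<close>, then \<open>(1, 1, a)\<close> solves
  \<open>(k - 2) x\<^sup>2 + 2 y\<^sup>2 = z\<^sup>2\<close>.

  For \<open>k \<equiv> 4, 5 (mod 8)\<close> one has \<open>n \<equiv> 3 (mod 4)\<close>, and the cyclic structure gives more than rational solvability:
  \<open>k - 2\<close> itself has the form \<open>z\<^sup>2 + 2 y\<^sup>2\<close>. A character of prime order \<open>q\<close> dividing \<open>n\<close> has squared absolute value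
  \<open>k - 2\<close> on \<open>X\<close>. If a power of the prime \<open>p\<close> is \<open>-1\<close> modulo \<open>q\<close>, then \<open>p\<close> divides \<open>k - 2\<close> to an even power
  (lemma \<open>self_conjugate_even_multiplicity\<close>, proved in \<open>\<int>[X]\<close> with the Frobenius congruence instead of the ideal
  theory of cyclotomic fields). Quadratic reciprocity supplies such a \<open>q\<close> for every prime \<open>p \<equiv> 3 (mod 4)\<close>
  dividing \<open>k - 2\<close>, and the remaining odd primes dividing \<open>k - 2\<close> are of the form \<open>x\<^sup>2 + 2 y\<^sup>2\<close> by Thue's lemma
  (lemma \<open>square_plus_two_squares_square_minus_2\<close>).
\<close>

section \<open>Congruences and Frobenius for integer polynomials\<close>

text \<open>
  Congruence modulo the ideal generated by the two elements \<open>a\<close> and \<open>b\<close>.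
\<close>

definition ideal_cong :: "'a::comm_ring_1 \<Rightarrow> 'a \<Rightarrow> 'a \<Rightarrow> 'a \<Rightarrow> bool" where
  "ideal_cong a b x y \<longleftrightarrow> (\<exists>u w. x - y = a * u + b * w)"

lemma ideal_congI1: "a dvd x - y \<Longrightarrow> ideal_cong a b x y"
  unfolding ideal_cong_def dvd_def by (metis add.right_neutral mult_zero_right)

lemma ideal_congI2: "b dvd x - y \<Longrightarrow> ideal_cong a b x y"
  unfolding ideal_cong_def dvd_def by (metis add.left_neutral mult_zero_right)

lemma ideal_cong_refl: "ideal_cong a b x x"
  by (rule ideal_congI1) simp

lemma ideal_cong_sym: "ideal_cong a b x y \<Longrightarrow> ideal_cong a b y x"
proof -
  assume "ideal_cong a b x y"
  then obtain u w where "x - y = a * u + b * w" unfolding ideal_cong_def by blast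
  then have "y - x = a * (- u) + b * (- w)" by (simp add: algebra_simps)
  then show ?thesis unfolding ideal_cong_def by blast
qed

lemma ideal_cong_trans [trans]:
  assumes "ideal_cong a b x y" "ideal_cong a b y z"
  shows "ideal_cong a b x z"
proof -
  obtain u w where "x - y = a * u + b * w" using assms(1) unfolding ideal_cong_def by blast
  moreover obtain u' w' where "y - z = a * u' + b * w'" using assms(2) unfolding ideal_cong_def by blast
  ultimately have "x - z = a * (u + u') + b * (w + w')" by (simp add: algebra_simps)
  then show ?thesis unfolding ideal_cong_def by blast
qed

lemma ideal_cong_mult:
  assumes "ideal_cong a b x y" "ideal_cong a b x' y'"
  shows "ideal_cong a b (x * x') (y * y')"
proof -
  obtain u w where "x - y = a * u + b * w" using assms(1) unfolding ideal_cong_def by blast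
  moreover obtain u' w' where "x' - y' = a * u' + b * w'" using assms(2) unfolding ideal_cong_def by blast
  moreover have "x * x' - y * y' = (x - y) * x' + y * (x' - y')" by (simp add: algebra_simps)
  ultimately have "x * x' - y * y' = a * (u * x' + y * u') + b * (w * x' + y * w')"
    by (simp add: algebra_simps)
  then show ?thesis unfolding ideal_cong_def by blast
qed

lemma of_nat_dvd_of_nat: "m dvd n \<Longrightarrow> (of_nat m :: 'a::comm_semiring_1) dvd of_nat n"
  by (auto elim!: dvdE)

lemma prime_dvd_add_power_diff:
  fixes x y :: "'a::comm_ring_1"
  assumes "prime p"
  shows "of_nat p dvd (x + y) ^ p - (x ^ p + y ^ p)"
proof -
  have p: "p > 0" using assms prime_gt_0_nat by blast
  have "{..p} = insert 0 (insert p {0<..<p})" using p by auto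
  then have "(x + y) ^ p = x ^ p + y ^ p + (\<Sum>k\<in>{0<..<p}. of_nat (p choose k) * x ^ k * y ^ (p - k))"
    using p by (simp add: binomial_ring add_ac)
  moreover have "of_nat p dvd (\<Sum>k\<in>{0<..<p}. of_nat (p choose k) * x ^ k * y ^ (p - k))"
  proof (rule dvd_sum)
    fix k assume "k \<in> {0<..<p}"
    then have "p dvd p choose k" using assms by (intro dvd_choose_prime) auto
    then have "of_nat p dvd (of_nat (p choose k) :: 'a)" by (rule of_nat_dvd_of_nat)
    then show "of_nat p dvd of_nat (p choose k) * x ^ k * y ^ (p - k)" by (simp add: dvd_mult2)
  qed
  ultimately show ?thesis by simp
qed

lemma dvd_power_diff_power:
  fixes x y :: "'a::comm_ring_1"
  assumes "d dvd x - y"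
  shows "d dvd x ^ n - y ^ n"
  using assms unfolding power_diff_sumr2 by (rule dvd_mult2)

lemma pcompose_power: "(f ^ n) \<circ>\<^sub>p g = (f \<circ>\<^sub>p g) ^ n"
  by (induction n) (simp_all add: pcompose_mult pcompose_1)

lemma prime_dvd_power_diff_self:
  fixes a :: int
  assumes "prime p"
  shows "int p dvd a ^ p - a"
proof (cases "int p dvd a")
  case True
  then have "int p dvd a ^ p" using assms by (meson dvd_power dvd_trans prime_gt_0_nat)
  then show ?thesis using True by (rule dvd_diff)
next
  case False
  let ?b = "nat (a mod int p)"
  have b: "int ?b = a mod int p" using assms prime_gt_0_nat by simp
  then have "\<not> p dvd ?b" using False by (metis dvd_mod_iff dvd_refl int_dvd_int_iff)
  then have "[?b ^ (p - 1) = 1] (mod p)" using fermat_theorem assms by blast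
  then have "[int ?b ^ (p - 1) = 1] (mod int p)" by (metis cong_int_iff of_nat_1 of_nat_power)
  then have "[a ^ (p - 1) = 1] (mod int p)" using b by (simp add: cong_def power_mod)
  then have "[a * a ^ (p - 1) = a * 1] (mod int p)" by (rule cong_scalar_left)
  moreover have "a * a ^ (p - 1) = a ^ p"
    using assms by (metis power_minus_mult prime_gt_0_nat mult.commute)
  ultimately show ?thesis by (simp add: cong_iff_dvd_diff)
qed

text \<open>
  \<open>A(X)^p\<close> and \<open>A(X^p)\<close> agree modulo \<open>p\<close>; the substitution is composition with the
  monomial \<open>[:0, 1:] ^ p\<close>.
\<close>

lemma frobenius_poly:
  fixes A :: "int poly"
  assumes "prime p"
  shows "of_nat p dvd A ^ p - A \<circ>\<^sub>p [:0, 1:] ^ p"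
proof (induction A)
  case 0
  then show ?case using assms by (simp add: prime_gt_0_nat power_0_left)
next
  case (pCons a A)
  let ?X = "[:0, 1:] :: int poly"
  have eq: "pCons a A = [:a:] + ?X * A" by simp
  have 1: "of_nat p dvd (pCons a A) ^ p - ([:a:] ^ p + (?X * A) ^ p)"
    unfolding eq by (rule prime_dvd_add_power_diff[OF assms])
  have "[:a:] ^ p - [:a:] = [:a ^ p - a:]" by (simp add: poly_const_pow)
  then have 2: "of_nat p dvd [:a:] ^ p - [:a:]"
    using prime_dvd_power_diff_self[OF assms] by (simp add: of_nat_poly)
  have 3: "of_nat p dvd ?X ^ p * (A ^ p - A \<circ>\<^sub>p ?X ^ p)" using pCons(2) by (rule dvd_mult)
  have "(pCons a A) ^ p - pCons a A \<circ>\<^sub>p ?X ^ p =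
     ((pCons a A) ^ p - ([:a:] ^ p + (?X * A) ^ p)) + ([:a:] ^ p - [:a:]) + ?X ^ p * (A ^ p - A \<circ>\<^sub>p ?X ^ p)"
    by (simp only: pcompose_pCons power_mult_distrib algebra_simps)
  then show ?case using dvd_add[OF dvd_add[OF 1 2] 3] by (simp only:)
qed

lemma frobenius_poly_iterated:
  fixes A :: "int poly"
  assumes "prime p"
  shows "of_nat p dvd A ^ (p ^ j) - A \<circ>\<^sub>p [:0, 1:] ^ (p ^ j)"
proof (induction j)
  case 0
  then show ?case by simp
next
  case (Suc j)
  let ?X = "[:0, 1:] :: int poly"
  let ?B = "A \<circ>\<^sub>p ?X ^ (p ^ j)"
  have 1: "of_nat p dvd (A ^ (p ^ j)) ^ p - ?B ^ p" by (rule dvd_power_diff_power[OF Suc])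
  have 2: "of_nat p dvd ?B ^ p - ?B \<circ>\<^sub>p ?X ^ p" by (rule frobenius_poly[OF assms])
  have "?B \<circ>\<^sub>p ?X ^ p = A \<circ>\<^sub>p ?X ^ (p ^ Suc j)"
    by (simp add: pcompose_assoc[symmetric] pcompose_power pcompose_pCons flip: power_mult)
  moreover have "(A ^ (p ^ j)) ^ p = A ^ (p ^ Suc j)"
    by (simp add: mult.commute flip: power_mult)
  ultimately show ?case using dvd_add[OF 1 2] by simp
qed

lemma pcompose_diff_dvd:
  fixes A x y :: "'a::comm_ring_1 poly"
  shows "x - y dvd A \<circ>\<^sub>p x - A \<circ>\<^sub>p y"
proof (induction A)
  case 0 then show ?case by simp
next
  case (pCons a A)
  have "pCons a A \<circ>\<^sub>p x - pCons a A \<circ>\<^sub>p y = (x - y) * (A \<circ>\<^sub>p x) + y * (A \<circ>\<^sub>p x - A \<circ>\<^sub>p y)"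
    by (simp only: pcompose_pCons algebra_simps)
  then show ?case using pCons by simp
qed

section \<open>Self-conjugate primes\<close>

text \<open>
  The polynomial \<open>1 + X + ... + X^(q-1)\<close>. Working modulo this divisor of \<open>X^q - 1\<close> means working in
  the group ring of the cyclic group of order \<open>q\<close> modulo the sum of all group elements.
  Since \<open>X^(q-1)\<close> is inverse to \<open>X\<close> there, \<open>A(X) \<mapsto> A(X^(q-1))\<close> plays the part of complex conjugation.
\<close>

definition all_ones_poly :: "nat \<Rightarrow> int poly" where
  "all_ones_poly q = (\<Sum>i<q. [:0, 1:] ^ i)"

lemma all_ones_dvd_power_minus_1: "all_ones_poly q dvd [:0, 1:] ^ (q * n) - 1"
proof -
  have "all_ones_poly q dvd [:0, 1:] ^ q - 1"
    unfolding all_ones_poly_def by (simp only: power_diff_1_eq dvd_triv_right)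
  also have "[:0, 1:] ^ q - 1 dvd ([:0, 1:] ^ q) ^ n - (1 :: int poly) ^ n"
    by (rule dvd_power_diff_power) simp
  finally show ?thesis by (simp add: power_mult)
qed

lemma all_ones_dvd_power_diff:
  assumes "[a = b] (mod q)"
  shows "all_ones_poly q dvd [:0, 1:] ^ a - [:0, 1:] ^ b"
proof -
  have *: "all_ones_poly q dvd [:0, 1:] ^ c - [:0, 1:] ^ (c mod q)" for c
  proof -
    have "[:0, 1:] ^ c - [:0, 1:] ^ (c mod q) =
        [:0, 1:] ^ (c mod q) * ([:0, 1:] ^ (q * (c div q)) - (1::int poly))"
      unfolding right_diff_distrib mult_1_right power_add[symmetric] by simp
    then show ?thesis using all_ones_dvd_power_minus_1 by simp
  qed
  have "[:0, 1:] ^ a - [:0, 1:] ^ b = ([:0, 1:] ^ a - [:0, 1:] ^ (a mod q)) -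
      ([:0, 1:] ^ b - ([:0, 1:] :: int poly) ^ (b mod q))"
    using assms by (simp add: cong_def)
  then show ?thesis using *[of a] *[of b] by (simp only: dvd_diff)
qed

lemma all_ones_dvd_pcompose_diff:
  assumes "[a = b] (mod q)"
  shows "all_ones_poly q dvd A \<circ>\<^sub>p [:0, 1:] ^ a - A \<circ>\<^sub>p [:0, 1:] ^ b"
  using all_ones_dvd_power_diff[OF assms] pcompose_diff_dvd dvd_trans by blast

lemma all_ones_dvd_pcompose:
  assumes "q > 0"
  shows "all_ones_poly q dvd all_ones_poly q \<circ>\<^sub>p [:0, 1:] ^ (q - 1)"
proof -
  let ?X = "[:0, 1:] :: int poly"
  have "all_ones_poly q \<circ>\<^sub>p ?X ^ (q - 1) = (\<Sum>i<q. (?X ^ (q - 1)) ^ i)"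
    unfolding all_ones_poly_def by (simp add: pcompose_sum pcompose_power pcompose_pCons)
  also have "\<dots> = (\<Sum>i<q. (?X ^ (q - 1)) ^ (q - Suc i))"
    by (rule sum.nat_diff_reindex[symmetric])
  finally have 1: "all_ones_poly q \<circ>\<^sub>p ?X ^ (q - 1) = (\<Sum>i<q. ?X ^ ((q - 1) * (q - Suc i)))"
    by (simp only: power_mult)
  (* modulo q the exponents (q - 1) * (q - Suc i) are i + 1, so the sum is X times the all-ones
     polynomial up to a multiple of the latter *)
  have "all_ones_poly q dvd (\<Sum>i<q. ?X ^ ((q - 1) * (q - Suc i)) - ?X ^ Suc i)"
  proof (rule dvd_sum, rule all_ones_dvd_power_diff)
    fix i assume i: "i \<in> {..<q}"
    have "(q - 1) * (q - Suc i) + q * Suc i = Suc i + q * (q - 1)"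
    proof -
      obtain r where r: "q = Suc i + r" using i by (metis lessThan_iff less_iff_Suc_add add_Suc)
      then show ?thesis by (simp add: algebra_simps)
    qed
    then show "[(q - 1) * (q - Suc i) = Suc i] (mod q)"
      by (metis cong_def mod_mult_self2)
  qed
  moreover have "(\<Sum>i<q. ?X ^ Suc i) = ?X * all_ones_poly q"
    unfolding all_ones_poly_def by (simp only: power_Suc sum_distrib_left)
  moreover have "(\<Sum>i<q. ?X ^ ((q - 1) * (q - Suc i))) =
     (\<Sum>i<q. ?X ^ ((q - 1) * (q - Suc i)) - ?X ^ Suc i) + (\<Sum>i<q. ?X ^ Suc i)"
    by (simp only: sum_subtractf diff_add_cancel)
  ultimately show ?thesis unfolding 1 by (simp only: dvd_add dvd_triv_right)
qed

lemma degree_all_ones_poly: "q > 0 \<Longrightarrow> degree (all_ones_poly q) = q - 1 \<and> lead_coeff (all_ones_poly q) = 1"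
proof (induction q rule: nat_induct_non_zero)
  case 1
  then show ?case by (simp add: all_ones_poly_def)
next
  case (Suc n)
  have eq: "all_ones_poly (Suc n) = all_ones_poly n + monom 1 n"
    unfolding all_ones_poly_def by (simp add: monom_altdef)
  have d: "degree (all_ones_poly n) < degree (monom (1::int) n)" using Suc by (simp add: degree_monom_eq)
  have "degree (all_ones_poly (Suc n)) = n" unfolding eq
    using degree_add_eq_right[OF d] by (simp add: degree_monom_eq)
  moreover have "coeff (all_ones_poly (Suc n)) n = 1" unfolding eq
    using d by (simp add: degree_monom_eq coeff_eq_0)
  ultimately show ?case by simp
qed

text \<open>
  If a multiple of a monic nonconstant polynomial is constant modulo \<open>c\<close>, then its cofactor vanishes
  modulo \<open>c\<close>; the coefficients of \<open>W\<close> are treated from the leading one downwards.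
\<close>

lemma const_dvd_monic_mult_plus_const:
  fixes G W :: "int poly"
  assumes "lead_coeff G = 1" "degree G > 0" "[:c:] dvd G * W + [:m:]"
  shows "[:c:] dvd W"
  using assms(3)
proof (induction "degree W" arbitrary: W rule: less_induct)
  case (less W)
  show ?case
  proof (cases "W = 0")
    case False
    have "coeff (G * W + [:m:]) (degree G + degree W) = lead_coeff W"
      using assms by (simp add: coeff_mult_degree_sum coeff_pCons split: nat.splits)
    then have lc: "c dvd lead_coeff W" using less.prems by (metis const_poly_dvd_iff)
    let ?M = "monom (lead_coeff W) (degree W)"
    have cM: "[:c:] dvd ?M" using lc by (auto simp: const_poly_dvd_iff)
    show ?thesis
    proof (cases "W = ?M")
      case True
      then show ?thesis using cM by simp
    next
      case False
      then have "degree W \<noteq> 0" by (metis monom_0 degree_eq_zeroE coeff_pCons_0)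
      have "degree (W - ?M) < degree W"
        using False \<open>degree W \<noteq> 0\<close>
        by (intro degree_less_if_less_eqI) (auto intro!: degree_diff_le simp: degree_monom_le)
      moreover have "G * (W - ?M) + [:m:] = (G * W + [:m:]) - G * ?M" by (simp add: algebra_simps)
      ultimately have "[:c:] dvd W - ?M" using less cM by (metis dvd_diff dvd_mult)
      then show ?thesis using cM by (metis dvd_add diff_add_cancel)
    qed
  qed simp
qed

text \<open>
  If \<open>A\<close> has squared absolute value \<open>m\<close> modulo the all-ones polynomial and some power of \<open>p\<close> is \<open>-1\<close>
  modulo \<open>q\<close>, then \<open>p\<close> divides \<open>m\<close> to an even power. Let \<open>p\<close> divide \<open>m\<close> and work modulo \<open>p\<close> and the all-ones
  polynomial. Frobenius gives \<open>A^(p^j) = A(X^(q-1))\<close>, so \<open>A^(p^j + 1) = m = 0\<close>, whereas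
  \<open>A^(p^(2 j)) = A\<close>; hence \<open>A = 0\<close>. So \<open>A\<close> is \<open>p\<close> times some \<open>B\<close> modulo the all-ones polynomial, and the
  argument repeats with \<open>B\<close> and \<open>m / p^2\<close>.
\<close>

lemma self_conjugate_even_multiplicity:
  fixes A :: "int poly" and m p q j :: nat
  assumes p: "prime p" and j: "j > 0" and q: "q > 1" and pj: "[p ^ j = q - 1] (mod q)"
    and "m > 0"
    and "all_ones_poly q dvd A * A \<circ>\<^sub>p [:0, 1:] ^ (q - 1) - of_nat m"
  shows "even (multiplicity p m)"
  using assms(5,6)
proof (induction m arbitrary: A rule: less_induct)
  case (less m)
  let ?X = "[:0, 1:] :: int poly" and ?F = "all_ones_poly q" and ?p = "of_nat p :: int poly"
  let ?A' = "A \<circ>\<^sub>p ?X ^ (q - 1)"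
  show ?case
  proof (cases "p dvd m")
    case False
    then show ?thesis by (simp add: not_dvd_imp_multiplicity_0)
  next
    case True
    have 1: "ideal_cong ?p ?F (A ^ (p ^ j)) ?A'"
      using frobenius_poly_iterated[OF p] all_ones_dvd_pcompose_diff[OF pj]
      by (meson ideal_congI1 ideal_congI2 ideal_cong_trans)
    have "[p ^ (2 * j) = (q - 1) ^ 2] (mod q)"
      using cong_pow[OF pj, of 2] by (simp add: power_mult[symmetric] mult.commute)
    also have "(q - 1) ^ 2 = 1 + q * (q - 2)"
      using q by (auto simp: power2_eq_square algebra_simps dest!: less_imp_Suc_add)
    also have "[1 + q * (q - 2) = 1] (mod q)" unfolding cong_def by (rule mod_mult_self2)
    finally have pp: "[p ^ (2 * j) = 1] (mod q)" .
    have 2: "ideal_cong ?p ?F (A ^ (p ^ (2 * j))) A"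
    proof -
      have "ideal_cong ?p ?F (A ^ (p ^ (2 * j))) (A \<circ>\<^sub>p ?X ^ (p ^ (2 * j)))"
        using frobenius_poly_iterated[OF p] by (rule ideal_congI1)
      also have "ideal_cong ?p ?F \<dots> (A \<circ>\<^sub>p ?X ^ 1)"
        using all_ones_dvd_pcompose_diff[OF pp] by (rule ideal_congI2)
      finally show ?thesis by simp
    qed
    have "ideal_cong ?p ?F (A * A ^ (p ^ j)) (A * ?A')"
      using 1 by (intro ideal_cong_mult ideal_cong_refl)
    also have "ideal_cong ?p ?F \<dots> (of_nat m)" using less.prems by (intro ideal_congI2) simp
    also have "ideal_cong ?p ?F \<dots> 0" using True by (intro ideal_congI1) (simp add: of_nat_dvd_of_nat)
    finally have 3: "ideal_cong ?p ?F (A ^ Suc (p ^ j)) 0" by simp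
    (* j > 0 is needed here: nilpotency must set in below the exponent p^(2j) *)
    have "Suc (p ^ j) \<le> p ^ (2 * j)"
      using j prime_gt_1_nat[OF p] by (simp add: Suc_le_eq)
    then have "A ^ (p ^ (2 * j)) = A ^ Suc (p ^ j) * A ^ (p ^ (2 * j) - Suc (p ^ j))"
      by (metis power_add le_add_diff_inverse)
    then have "ideal_cong ?p ?F (A ^ (p ^ (2 * j))) 0"
      using ideal_cong_mult[OF 3 ideal_cong_refl] by simp
    then have "ideal_cong ?p ?F A 0" using 2 ideal_cong_sym ideal_cong_trans by blast
    then obtain B C where A: "A = ?p * B + ?F * C" unfolding ideal_cong_def by auto
    let ?B' = "B \<circ>\<^sub>p ?X ^ (q - 1)"
    have A': "?A' = ?p * ?B' + (?F \<circ>\<^sub>p ?X ^ (q - 1)) * (C \<circ>\<^sub>p ?X ^ (q - 1))"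
      unfolding A by (simp add: pcompose_add pcompose_mult pcompose_smult of_nat_poly)
    obtain D where D: "?F \<circ>\<^sub>p ?X ^ (q - 1) = ?F * D"
      using all_ones_dvd_pcompose[of q] q by (auto elim: dvdE)
    have "?F dvd A * ?A' - ?p * ?p * (B * ?B')"
    proof -
      have "A * ?A' - ?p * ?p * (B * ?B') = ?F * (C * ?A' + ?p * B * D * (C \<circ>\<^sub>p ?X ^ (q - 1)))"
        unfolding A' D by (subst A) (simp add: algebra_simps)
      then show ?thesis by (metis dvd_triv_left)
    qed
    then have "?F dvd (A * ?A' - of_nat m) - (A * ?A' - ?p * ?p * (B * ?B'))"
      using less.prems(2) by (rule dvd_diff[rotated])
    then obtain W where W: "?p * ?p * (B * ?B') - of_nat m = ?F * W" by (auto elim: dvdE)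
    then have "?F * W + [:int m:] = [:int (p * p):] * (B * ?B')"
      by (simp add: of_nat_poly algebra_simps)
    then have "[:int (p * p):] dvd ?F * W + [:int m:]" by (metis dvd_triv_left)
    moreover have "lead_coeff ?F = 1" using degree_all_ones_poly[of q] q by linarith
    moreover have "degree ?F > 0" using degree_all_ones_poly[of q] q by simp
    ultimately have "[:int (p * p):] dvd W" by (metis const_dvd_monic_mult_plus_const)
    then obtain V where "W = [:int (p * p):] * V" by (rule dvdE)
    then have V: "W = ?p * ?p * V" by (simp add: of_nat_poly)
    have meq: "of_nat m = ?p * ?p * (B * ?B' - ?F * V)" using W V by (simp add: algebra_simps)
    then have "[:int m:] = [:int (p * p):] * (B * ?B' - ?F * V)" by (simp add: of_nat_poly)
    then have "[:int (p * p):] dvd [:int m:]" by (rule dvdI)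
    then have "p * p dvd m" by (simp del: of_nat_mult)
    then obtain n where n: "m = p * p * n" by (auto elim: dvdE)
    have "?p * ?p * of_nat n = ?p * ?p * (B * ?B' - ?F * V)" using meq n by simp
    moreover have p0: "?p * ?p \<noteq> 0" using p by auto
    ultimately have "of_nat n = B * ?B' - ?F * V" by (simp only: mult_cancel_left) simp
    then have "B * ?B' - of_nat n = ?F * V" by simp
    then have dv: "?F dvd B * ?B' - of_nat n" by simp
    have "1 < p * p" using prime_gt_1_nat[OF p] by (simp only: less_1_mult)
    then have n0: "n > 0" "n < m" using n less.prems(1) by auto
    have "multiplicity p m = 2 + multiplicity p n"
      using n n0 p by (simp add: prime_elem_multiplicity_mult_distrib mult.assoc prime_gt_0_nat)
    then show ?thesis using less.IH[OF n0(2,1) dv] by simp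
  qed
qed

section \<open>Legendre symbols and reciprocity\<close>

lemma Legendre_range: "Legendre a p \<in> {-1, 0, 1}"
  by (simp add: Legendre_def)

lemma Legendre_cong:
  assumes "[a = b] (mod p)"
  shows "Legendre a p = Legendre b p"
proof -
  have "[a = 0] (mod p) \<longleftrightarrow> [b = 0] (mod p)"
    using assms by (meson cong_sym cong_trans)
  moreover have "QuadRes p a \<longleftrightarrow> QuadRes p b"
    unfolding QuadRes_def using assms by (meson cong_sym cong_trans)
  ultimately show ?thesis by (simp only: Legendre_def)
qed

lemma cong_small_imp_eq:
  fixes a b :: int
  assumes "[a = b] (mod int p)" "p > 2" "a \<in> {-1, 0, 1}" "b \<in> {-1, 0, 1}"
  shows "a = b"
proof -
  have "int p dvd a - b" using assms(1) by (simp add: cong_iff_dvd_diff)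
  moreover have "\<bar>a - b\<bar> < int p" using assms(2-4) by auto
  ultimately show ?thesis using dvd_imp_le_int[of "a - b" "int p"] by (cases "a = b") simp_all
qed

lemma Legendre_mult:
  assumes "prime p" "p > 2"
  shows "Legendre (a * b) (int p) = Legendre a (int p) * Legendre b (int p)"
proof (rule cong_small_imp_eq[OF _ assms(2)])
  have "[Legendre (a * b) (int p) = (a * b) ^ ((p - 1) div 2)] (mod int p)"
    using assms by (rule euler_criterion)
  also have "(a * b) ^ ((p - 1) div 2) = a ^ ((p - 1) div 2) * b ^ ((p - 1) div 2)"
    by (simp add: power_mult_distrib)
  also have "[a ^ ((p - 1) div 2) * b ^ ((p - 1) div 2) = Legendre a (int p) * Legendre b (int p)] (mod int p)"
    using assms by (intro cong_mult cong_sym[OF euler_criterion])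
  finally show "[Legendre (a * b) (int p) = Legendre a (int p) * Legendre b (int p)] (mod int p)" .
  show "Legendre a (int p) * Legendre b (int p) \<in> {-1, 0, 1}"
    using Legendre_range[of a "int p"] Legendre_range[of b "int p"] by auto
qed (rule Legendre_range)

text \<open>
  Reciprocity for the composite number \<open>M\<close>, in the special case in which \<open>p\<close> is a square modulo every
  prime divisor of \<open>M\<close>.
\<close>

lemma Legendre_reciprocity_product:
  fixes p M :: nat
  assumes "prime p" "p mod 4 = 3" "odd M"
    and "\<And>q. prime q \<Longrightarrow> q dvd M \<Longrightarrow> q \<noteq> p \<and> Legendre (int p) (int q) = 1"
  shows "Legendre (int M) (int p) = (if M mod 4 = 1 then 1 else -1)"
  using assms(3,4)
proof (induction M rule: prime_divisors_induct)
  case zero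
  then show ?case by simp
next
  case (unit M)
  have "p > 1" using assms(1) prime_gt_1_nat by blast
  moreover have "QuadRes (int p) 1" unfolding QuadRes_def by (rule exI[of _ 1]) simp
  ultimately show ?case using unit by (simp add: Legendre_def cong_def)
next
  case (factor q M)
  have "p \<ge> 2" "p \<noteq> 2" using assms(1,2) prime_ge_2_nat by auto
  then have p2: "p > 2" by simp
  have q: "prime q" "odd q" "q \<noteq> p" "Legendre (int p) (int q) = 1" and M: "odd M"
    using factor by auto
  have "q \<ge> 2" "q \<noteq> 2" using q(1,2) prime_ge_2_nat by auto
  then have q2: "q > 2" by simp
  have IH: "Legendre (int M) (int p) = (if M mod 4 = 1 then 1 else -1)"
    using factor by auto
  have "Legendre (int q) (int p) = (-1) ^ ((p - 1) div 2 * ((q - 1) div 2))"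
    using Quadratic_Reciprocity[of p q] assms(1) p2 q q2 by simp
  moreover have "odd ((p - 1) div 2)" using assms(2) by presburger
  moreover have "even ((q - 1) div 2) \<longleftrightarrow> q mod 4 = 1" using \<open>odd q\<close> by presburger
  ultimately have "Legendre (int q) (int p) = (if q mod 4 = 1 then 1 else -1)"
    by (simp add: minus_one_power_iff)
  moreover have "q * M mod 4 = (q mod 4) * (M mod 4) mod 4" by (simp add: mod_mult_eq)
  moreover have "q mod 4 = 1 \<or> q mod 4 = 3" using \<open>odd q\<close> by presburger
  moreover have "M mod 4 = 1 \<or> M mod 4 = 3" using M by presburger
  ultimately have "Legendre (int q) (int p) * Legendre (int M) (int p) = (if q * M mod 4 = 1 then 1 else -1)"
    unfolding IH by (elim disjE) simp_all
  then show ?case using Legendre_mult[OF assms(1) p2, of "int q" "int M"] by simp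
qed

lemma ex_prime_divisor_Legendre_eq_minus_1:
  fixes p N :: nat
  assumes "prime p" "p mod 4 = 3" "N mod 4 = 3" "Legendre (int N) (int p) = 1"
  shows "\<exists>q. prime q \<and> q dvd N \<and> Legendre (int p) (int q) = -1"
proof (rule ccontr)
  assume *: "\<not> ?thesis"
  have "\<not> int p dvd int N" using assms(4) by (auto simp: Legendre_def cong_0_iff split: if_splits)
  then have pN: "\<not> p dvd N" by simp
  have "Legendre (int N) (int p) = (if N mod 4 = 1 then 1 else -1)"
  proof (rule Legendre_reciprocity_product[OF assms(1,2)])
    show "odd N" using assms(3) by presburger
    fix q assume q: "prime q" "q dvd N"
    have "q \<noteq> p" using q pN by auto
    then have "\<not> int q dvd int p" using q assms(1) primes_dvd_imp_eq by auto
    then have "Legendre (int p) (int q) \<noteq> 0" by (simp add: Legendre_def cong_0_iff)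
    then show "q \<noteq> p \<and> Legendre (int p) (int q) = 1"
      using \<open>q \<noteq> p\<close> * q Legendre_range[of "int p" "int q"] by auto
  qed
  then show False using assms by simp
qed

section \<open>Numbers represented by a square plus twice a square\<close>

lemma Thue_lemma:
  fixes u :: int and p :: nat
  assumes p0: "p > 0"
  shows "\<exists>(x :: int) (y :: int). (x, y) \<noteq> (0, 0) \<and> x\<^sup>2 \<le> p \<and> y\<^sup>2 \<le> p \<and> [x = u * y] (mod int p)"
proof -
  define m where "m = floor_sqrt p"
  have m1: "m\<^sup>2 \<le> p" and m2: "p < (Suc m)\<^sup>2"
    unfolding m_def by (simp_all only: floor_sqrt_power2_le Suc_floor_sqrt_power2_gt)
  let ?f = "\<lambda>(a, b). (int a - u * int b) mod int p"
  have "card (?f ` ({0..m} \<times> {0..m})) \<le> card {0..<int p}"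
    using p0 by (intro card_mono) auto
  also have "\<dots> < card ({0..m} \<times> {0..m})"
    using m2 by (simp add: power2_eq_square card_cartesian_product)
  finally have "\<not> inj_on ?f ({0..m} \<times> {0..m})" using pigeonhole by blast
  then obtain a b a' b' where ab: "a \<le> m" "b \<le> m" "a' \<le> m" "b' \<le> m" "(a, b) \<noteq> (a', b')"
    "(int a - u * int b) mod int p = (int a' - u * int b') mod int p"
    unfolding inj_on_def by auto
  have bound: "(int c - int c')\<^sup>2 \<le> p" if "c \<le> m" "c' \<le> m" for c c'
  proof -
    have "\<bar>int c - int c'\<bar> \<le> int m" using that by auto
    then have "(int c - int c')\<^sup>2 \<le> (int m)\<^sup>2" using abs_le_square_iff by fastforce
    then show ?thesis using m1 by (metis of_nat_le_iff of_nat_power order_trans)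
  qed
  have "int p dvd (int a - u * int b) - (int a' - u * int b')"
    using ab(6) by (simp add: mod_eq_dvd_iff)
  then have "[int a - int a' = u * (int b - int b')] (mod int p)"
    by (simp add: cong_iff_dvd_diff algebra_simps)
  moreover have "(int a - int a', int b - int b') \<noteq> (0, 0)" using ab(5) by auto
  ultimately show ?thesis
    using bound[OF ab(1,3)] bound[OF ab(2,4)]
    by (intro exI[of _ "int a - int a'"] exI[of _ "int b - int b'"] conjI)
qed

text \<open>
  The numbers represented by the binary quadratic form \<open>x\<^sup>2 + 2 y\<^sup>2\<close>, that is, the norms from
  \<open>\<int>[\<surd>-2]\<close>.
\<close>

definition square_plus_two_squares :: "nat \<Rightarrow> bool" where
  "square_plus_two_squares n \<longleftrightarrow> (\<exists>(x :: int) (y :: int). int n = x\<^sup>2 + 2 * y\<^sup>2)"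

lemma square_plus_two_squares_mult:
  assumes "square_plus_two_squares m" "square_plus_two_squares n"
  shows "square_plus_two_squares (m * n)"
proof -
  obtain x y z w :: int where "int m = x\<^sup>2 + 2 * y\<^sup>2" "int n = z\<^sup>2 + 2 * w\<^sup>2"
    using assms unfolding square_plus_two_squares_def by blast
  then have "int (m * n) = (x * z - 2 * y * w)\<^sup>2 + 2 * (x * w + y * z)\<^sup>2"
    by (simp add: power2_eq_square algebra_simps)
  then show ?thesis unfolding square_plus_two_squares_def by blast
qed

lemma square_plus_two_squares_square: "square_plus_two_squares (n\<^sup>2)"
  unfolding square_plus_two_squares_def by (rule exI[of _ "int n"], rule exI[of _ 0]) simp

lemma square_plus_two_squares_prime:
  assumes "prime p" "Legendre (- 2) (int p) = 1"
  shows "square_plus_two_squares p"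
proof -
  obtain u where u: "[u\<^sup>2 = - 2] (mod int p)"
    using assms(2) by (auto simp: Legendre_def QuadRes_def split: if_splits)
  have p0: "p > 0" using assms prime_gt_0_nat by blast
  obtain x y :: int where xy: "(x, y) \<noteq> (0, 0)" "x\<^sup>2 \<le> p" "y\<^sup>2 \<le> p" "[x = u * y] (mod int p)"
    using Thue_lemma[OF p0] by blast
  have sq: "z\<^sup>2 \<noteq> int p" for z :: int
  proof
    assume "z\<^sup>2 = int p"
    moreover have "int (nat \<bar>z\<bar> ^ 2) = z\<^sup>2" by simp
    ultimately have "p = nat \<bar>z\<bar> ^ 2" by (simp only: of_nat_eq_iff)
    then have "prime (nat \<bar>z\<bar> ^ 2)" using assms(1) by (simp only:)
    then show False by (simp only: prime_power_iff) simp
  qed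
  have "[x\<^sup>2 = u\<^sup>2 * y\<^sup>2] (mod int p)" using cong_pow[OF xy(4), of 2] by (simp add: power_mult_distrib)
  also have "[u\<^sup>2 * y\<^sup>2 = - 2 * y\<^sup>2] (mod int p)" using u by (rule cong_scalar_right)
  finally have "int p dvd x\<^sup>2 + 2 * y\<^sup>2" by (simp add: cong_iff_dvd_diff)
  then obtain c where c: "x\<^sup>2 + 2 * y\<^sup>2 = int p * c" by (auto elim: dvdE)
  have "x\<^sup>2 + 2 * y\<^sup>2 > 0" using xy(1)
    by (cases "x = 0") (simp_all add: add_pos_nonneg)
  then have "c > 0" using c p0 by (metis of_nat_0_less_iff zero_less_mult_pos)
  moreover have "x\<^sup>2 + 2 * y\<^sup>2 < int p * 3" using xy(2,3) sq[of x] by auto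
  then have "c < 3" using c p0 by simp
  ultimately consider "c = 1" | "c = 2" by linarith
  then show ?thesis
  proof cases
    case 1
    then show ?thesis using c unfolding square_plus_two_squares_def by (metis mult.right_neutral)
  next
    case 2
    then have "x\<^sup>2 = 2 * (int p - y\<^sup>2)" using c by simp
    then have "even (x\<^sup>2)" by simp
    then obtain z where "x = 2 * z" by (auto elim: evenE)
    then have "int p = y\<^sup>2 + 2 * z\<^sup>2" using c 2 by (simp add: power2_eq_square)
    then show ?thesis unfolding square_plus_two_squares_def by blast
  qed
qed

lemma square_plus_two_squaresI:
  assumes "n > 0" "\<And>p. prime p \<Longrightarrow> odd (multiplicity p n) \<Longrightarrow> square_plus_two_squares p"
  shows "square_plus_two_squares n"
  using assms
proof (induction n rule: less_induct)
  case (less n)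
  show ?case
  proof (cases "n = 1")
    case True
    then show ?thesis using square_plus_two_squares_square[of 1] by simp
  next
    case False
    then obtain p where p: "prime p" "p dvd n" using prime_factor_nat by blast
    have p1: "p > 1" using p prime_gt_1_nat by blast
    (* split off from n a represented factor of the form p or p^2 *)
    define d where "d = (if square_plus_two_squares p then p else p\<^sup>2)"
    have d: "square_plus_two_squares d" "d > 1"
      using p1 one_less_power[of p 2] by (auto simp: d_def square_plus_two_squares_square)
    have "d dvd n"
    proof (cases "square_plus_two_squares p")
      case False
      then have "even (multiplicity p n)" using less.prems p by blast
      moreover have "multiplicity p n > 0" using p less.prems by (simp add: prime_multiplicity_gt_zero_iff)
      ultimately have "2 \<le> multiplicity p n" by presburger
      then show ?thesis using False by (simp add: d_def multiplicity_dvd')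
    qed (simp add: d_def p)
    then obtain m where m: "n = d * m" by (auto elim: dvdE)
    have m0: "m > 0" "m < n" using m d less.prems by auto
    have "square_plus_two_squares m"
    proof (rule less.IH[OF m0(2,1)])
      fix r assume r: "prime r" "odd (multiplicity r m)"
      have "multiplicity r n = multiplicity r d + multiplicity r m"
        using m m0 d r by (simp add: prime_elem_multiplicity_mult_distrib)
      then show "square_plus_two_squares r"
      proof (cases "square_plus_two_squares p")
        case True
        show ?thesis
        proof (cases "r = p")
          case False
          then have "multiplicity r d = 0" using True p r by (simp add: d_def prime_multiplicity_other)
          then show ?thesis using \<open>multiplicity r n = _\<close> r less.prems(2) by simp
        qed (use True in simp)
      next
        case False
        then have "multiplicity r d = 2 * multiplicity r p"
          using r p1 by (simp add: d_def prime_elem_multiplicity_power_distrib)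
        then show ?thesis using \<open>multiplicity r n = _\<close> r less.prems(2) by simp
      qed
    qed
    then show ?thesis using m d square_plus_two_squares_mult by blast
  qed
qed

text \<open>
  The last assumption says that primes which are self-conjugate modulo a prime divisor of \<open>N\<close> divide
  \<open>k - 2\<close> to an even power. Let the odd prime \<open>p\<close> divide \<open>k - 2\<close> to an odd power; as \<open>k\<close> is a square, \<open>2\<close>
  is a square modulo \<open>p\<close>. If \<open>p \<equiv> 1 (mod 4)\<close> then \<open>-2\<close> is a square too and \<open>p\<close> is represented. If
  \<open>p \<equiv> 3 (mod 4)\<close> then \<open>N \<equiv> 2 (mod p)\<close> is a square modulo \<open>p\<close>, so reciprocity and \<open>N \<equiv> 3 (mod 4)\<close> yield a
  prime divisor \<open>q\<close> of \<open>N\<close> modulo which \<open>p\<close> is not a square. By Euler's criterion \<open>p\<close> is then self-conjugate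
  modulo \<open>q\<close>, a contradiction.
\<close>

lemma square_plus_two_squares_square_minus_2:
  fixes a N :: nat
  defines "k \<equiv> a\<^sup>2"
  assumes k: "k \<ge> 3" and N: "2 * N = k\<^sup>2 - k + 2" "N mod 4 = 3"
    and self_conj: "\<And>p q j. prime p \<Longrightarrow> prime q \<Longrightarrow> q dvd N \<Longrightarrow> j > 0 \<Longrightarrow> [p ^ j = q - 1] (mod q) \<Longrightarrow>
        even (multiplicity p (k - 2))"
  shows "square_plus_two_squares (k - 2)"
proof (rule square_plus_two_squaresI)
  show "k - 2 > 0" using k by simp
  fix p assume p: "prime p" "odd (multiplicity p (k - 2))"
  have dvd: "p dvd k - 2" using p(2) not_dvd_imp_multiplicity_0 by (metis even_zero)
  show "square_plus_two_squares p"
  proof (cases "p = 2")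
    case True
    show ?thesis unfolding square_plus_two_squares_def True
      by (rule exI[of _ 0], rule exI[of _ 1]) simp
  next
    case False
    then have p2: "p > 2" using p prime_ge_2_nat[of p] by simp
    have oddp: "odd p" using p p2 prime_odd_nat by blast
    have "int k - 2 = int (k - 2)" using k by simp
    then have dvd': "int p dvd int k - 2" using dvd by (simp only: int_dvd_int_iff)
    have p_not_2: "\<not> int p dvd 2" using p2 by (auto dest: zdvd_imp_le)
    have "[(int a)\<^sup>2 = 2] (mod int p)" using dvd' unfolding k_def by (simp add: cong_iff_dvd_diff)
    then have L2: "Legendre 2 (int p) = 1" using p_not_2
      by (auto simp: Legendre_def QuadRes_def cong_0_iff)
    have "p mod 4 = 1 \<or> p mod 4 = 3" using oddp by presburger
    then show ?thesis
    proof
      assume "p mod 4 = 1"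
      then have "even ((p - 1) div 2)" by presburger
      then have "[Legendre (- 1) (int p) = 1] (mod int p)"
        using euler_criterion[OF p(1) p2, of "- 1"] by simp
      then have "Legendre (- 1) (int p) = 1"
        by (rule cong_small_imp_eq[OF _ p2 Legendre_range]) simp
      then have "Legendre (- 2) (int p) = 1"
        using Legendre_mult[OF p(1) p2, of "- 1" 2] L2 by simp
      then show ?thesis using square_plus_two_squares_prime p by blast
    next
      assume p4: "p mod 4 = 3"
      have "k \<le> k\<^sup>2" by (simp add: power2_eq_square)
      then have "2 * N + k = k\<^sup>2 + 2" using N(1) by simp
      then have "int (2 * N + k) = int (k\<^sup>2 + 2)" by (simp only:)
      then have "2 * (int N - 2) = (int k - 2) * (int k + 1)" by (simp add: power2_eq_square algebra_simps)
      then have "int p dvd 2 * (int N - 2)" using dvd' by simp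
      then have "int p dvd int N - 2"
        using p(1) p_not_2 by (metis prime_dvd_mult_iff prime_nat_int_transfer)
      then have cN: "[int N = 2] (mod int p)" by (simp add: cong_iff_dvd_diff)
      then have "Legendre (int N) (int p) = Legendre 2 (int p)" by (rule Legendre_cong)
      then obtain q where q: "prime q" "q dvd N" "Legendre (int p) (int q) = -1"
        using ex_prime_divisor_Legendre_eq_minus_1[OF p(1) p4 N(2)] L2 by auto
      have "odd N" using N(2) by presburger
      then have oddq: "odd q" using q(2) by auto
      then have q2: "q > 2" using prime_ge_2_nat[OF q(1)] by (cases "q = 2") auto
      let ?j = "(q - 1) div 2"
      have "[int p ^ ?j = - 1] (mod int q)"
        using euler_criterion[OF q(1) q2, of "int p"] q(3) by (simp add: cong_sym_eq)
      also have "[- 1 = int (q - 1)] (mod int q)" using q2 by (simp add: cong_iff_dvd_diff of_nat_diff)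
      finally have "[p ^ ?j = q - 1] (mod q)" by (metis cong_int_iff of_nat_power)
      moreover have "?j > 0" using q2 oddq by presburger
      ultimately have "even (multiplicity p (k - 2))" using self_conj[OF p(1) q(1,2)] by simp
      then show ?thesis using p(2) by simp
    qed
  qed
qed

section \<open>Character sums over the ruler\<close>

text \<open>
  The differences take all nonzero residues but one. The missing one is \<open>v / 2\<close>, since \<open>y - x = v / 2\<close> would
  give \<open>x - y\<close> the same residue.
\<close>

lemma modular_golomb_ruler_differences:
  assumes "modular_golomb_ruler v k X" and v: "v = k\<^sup>2 - k + 2"
  shows "(\<lambda>(x, y). (y - x) mod int v) ` {(x, y). x \<in> X \<and> y \<in> X \<and> x \<noteq> y} = {0<..<int v} - {int v div 2}"
    (is "?d ` ?P = _")
proof (rule card_subset_eq)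
  have X: "X \<subseteq> {0..<int v}" "card X = k" "k \<ge> 3" and inj: "inj_on ?d ?P"
    using assms(1) unfolding modular_golomb_ruler_def by auto
  have fin: "finite X" using X(1) finite_subset by blast
  have kk: "k \<le> k\<^sup>2" by (simp add: power2_eq_square)
  have "even (k\<^sup>2 + k)" by simp
  moreover have "v + k = k\<^sup>2 + 2" using kk by (simp add: v)
  ultimately have "even v" by presburger
  then have v2: "int v = 2 * (int v div 2)" by simp
  have v_pos: "int v > 0" using v by simp
  have "?P = X \<times> X - (\<lambda>x. (x, x)) ` X" by auto
  then have "card ?P = card (X \<times> X) - card ((\<lambda>x. (x, x)) ` X)"
    using fin by (simp only:) (intro card_Diff_subset, auto)
  also have "card ((\<lambda>x. (x, x)) ` X) = k" using X(2) by (simp add: card_image inj_on_def)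
  finally have "card ?P = k\<^sup>2 - k" using X(2) by (simp add: card_cartesian_product power2_eq_square)
  then have "card (?d ` ?P) = k\<^sup>2 - k" using card_image[OF inj] by simp
  moreover have "card ({0<..<int v} - {int v div 2}) = k\<^sup>2 - k"
    using v_pos v2 v by (subst card_Diff_singleton) auto
  ultimately show "card (?d ` ?P) = card ({0<..<int v} - {int v div 2})" by simp
  show "?d ` ?P \<subseteq> {0<..<int v} - {int v div 2}"
  proof clarify
    fix x y assume xy: "x \<in> X" "y \<in> X" "x \<noteq> y"
    let ?e = "(y - x) mod int v"
    have range: "0 \<le> ?e" "?e < int v" using v_pos by simp_all
    have "x \<in> {0..<int v}" "y \<in> {0..<int v}" using xy X(1) by blast+
    then have "\<bar>y - x\<bar> < int v" unfolding atLeastLessThan_iff by linarith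
    then have "\<not> int v dvd y - x" using xy(3) zdvd_not_zless[of "\<bar>y - x\<bar>" "int v"] by simp
    then have ne: "?e \<noteq> 0" by (simp add: dvd_eq_mod_eq_0)
    have "?e \<noteq> int v div 2"
    proof
      assume half: "?e = int v div 2"
      have "(x - y) mod int v = int v - ?e"
        using ne zmod_zminus1_eq_if[of "y - x" "int v"] by simp
      then have "?d (x, y) = ?d (y, x)" using half v2 by simp
      then show False using inj_onD[OF inj, of "(x, y)" "(y, x)"] xy by simp
    qed
    then show "?e \<in> {0<..<int v} - {int v div 2}" using range ne by simp
  qed
qed simp

lemma sum_periodic:
  fixes f :: "int \<Rightarrow> 'a::comm_ring_1"
  assumes "\<And>d. f (d mod int q) = f d"
  shows "(\<Sum>d\<in>{0..<int (q * c)}. f d) = of_nat c * (\<Sum>d\<in>{0..<int q}. f d)"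
proof (induction c)
  case 0
  then show ?case by simp
next
  case (Suc c)
  have "{0..<int (q * Suc c)} = {0..<int (q * c)} \<union> (\<lambda>d. d + int (q * c)) ` {0..<int q}"
    using image_add_int_atLeastLessThan[of "int (q * c)" "int (q * Suc c)"]
    by (simp add: algebra_simps ivl_disj_un_two(3))
  then have "(\<Sum>d\<in>{0..<int (q * Suc c)}. f d) = (\<Sum>d\<in>{0..<int (q * c)}. f d) +
      (\<Sum>d\<in>(\<lambda>d. d + int (q * c)) ` {0..<int q}. f d)"
    by (simp only:) (rule sum.union_disjoint, auto)
  also have "(\<Sum>d\<in>(\<lambda>d. d + int (q * c)) ` {0..<int q}. f d) = (\<Sum>d\<in>{0..<int q}. f (d + int (q * c)))"
    by (subst sum.reindex) (auto simp: inj_on_def)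
  also have "\<dots> = (\<Sum>d\<in>{0..<int q}. f d)"
  proof (rule sum.cong)
    fix d
    show "f (d + int (q * c)) = f d"
      using assms[of "d + int (q * c)"] assms[of d] by simp
  qed simp
  finally show ?case using Suc by (simp add: algebra_simps)
qed

text \<open>
  For a character \<open>f\<close> of order dividing \<open>q\<close> the left-hand side is \<open>\<bar>\<Sum>x\<in>X. f x\<bar>\<^sup>2\<close>.
\<close>

lemma modular_golomb_ruler_double_sum:
  fixes f :: "int \<Rightarrow> 'a::comm_ring_1"
  assumes mgr: "modular_golomb_ruler v k X" and v: "v = k\<^sup>2 - k + 2"
    and q: "q dvd v" and f: "\<And>d. f (d mod int q) = f d"
  shows "(\<Sum>x\<in>X. \<Sum>y\<in>X. f (y - x)) =
    of_nat k * f 0 + of_nat (v div q) * (\<Sum>d\<in>{0..<int q}. f d) - f 0 - f (int v div 2)"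
proof -
  let ?P = "{(x, y). x \<in> X \<and> y \<in> X \<and> x \<noteq> y}" and ?d = "\<lambda>(x, y). (y - x) mod int v"
  let ?h = "int v div 2"
  have X: "X \<subseteq> {0..<int v}" "card X = k" and inj: "inj_on ?d ?P"
    using mgr unfolding modular_golomb_ruler_def by auto
  have "int v \<ge> 2" using v by simp
  then have h: "0 < ?h" "?h < int v" by presburger+
  have fin: "finite X" using X(1) finite_subset by blast
  have finP: "finite ?P" by (rule finite_subset[of _ "X \<times> X"]) (use fin in auto)
  have fv: "f (d mod int v) = f d" for d
    using f[of d] f[of "d mod int v"] q by (simp add: mod_mod_cancel)
  have "(\<Sum>x\<in>X. \<Sum>y\<in>X. f (y - x)) = (\<Sum>(x, y)\<in>X \<times> X. f (y - x))"
    by (rule sum.cartesian_product)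
  also have "X \<times> X = (\<lambda>x. (x, x)) ` X \<union> ?P" by auto
  also have "(\<Sum>(x, y)\<in>(\<lambda>x. (x, x)) ` X \<union> ?P. f (y - x)) =
      (\<Sum>(x, y)\<in>(\<lambda>x. (x, x)) ` X. f (y - x)) + (\<Sum>(x, y)\<in>?P. f (y - x))"
    using fin finP by (intro sum.union_disjoint) auto
  also have "(\<Sum>(x, y)\<in>(\<lambda>x. (x, x)) ` X. f (y - x)) = of_nat k * f 0"
    using X(2) by (subst sum.reindex) (auto simp: inj_on_def)
  also have "(\<Sum>(x, y)\<in>?P. f (y - x)) = (\<Sum>z\<in>?P. f (?d z))"
    by (rule sum.cong) (auto simp: fv)
  also have "\<dots> = (\<Sum>d\<in>?d ` ?P. f d)" using sum.reindex[OF inj, of f] by (simp add: o_def)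
  also have "\<dots> = (\<Sum>d\<in>{0<..<int v} - {?h}. f d)"
    using modular_golomb_ruler_differences[OF mgr v] by simp
  also have "\<dots> = (\<Sum>d\<in>{0..<int v} - {0} - {?h}. f d)"
    by (rule sum.cong) auto
  also have "\<dots> = (\<Sum>d\<in>{0..<int v}. f d) - f 0 - f ?h"
    using h by (simp add: sum_diff1)
  also have "(\<Sum>d\<in>{0..<int v}. f d) = of_nat (v div q) * (\<Sum>d\<in>{0..<int q}. f d)"
    using sum_periodic[of f q "v div q", OF f] q by simp
  finally show ?thesis by (simp add: add_diff_eq)
qed

lemma modular_golomb_ruler_parity_sum:
  assumes mgr: "modular_golomb_ruler v k X" and v: "v = k\<^sup>2 - k + 2" "v = 2 * n"
  shows "is_square (if even n then int k - 2 else int k)"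
proof -
  (* the character of order 2; it takes the value (-1)^n at the missing difference n *)
  define e where "e d = (if even d then 1 else - 1 :: int)" for d :: int
  have "(\<Sum>d\<in>{0..<int 2}. e d) = 0"
  proof -
    have "{0..<int 2} = {0, 1}" by auto
    then show ?thesis by (simp add: e_def)
  qed
  moreover have "(\<Sum>x\<in>X. \<Sum>y\<in>X. e (y - x)) =
      of_nat k * e 0 + of_nat (v div 2) * (\<Sum>d\<in>{0..<int 2}. e d) - e 0 - e (int v div 2)"
    using v(2) by (intro modular_golomb_ruler_double_sum[OF mgr v(1)]) (simp_all add: e_def even_iff_mod_2_eq_zero)
  moreover have "(\<Sum>x\<in>X. \<Sum>y\<in>X. e (y - x)) = (\<Sum>x\<in>X. e x)\<^sup>2"
    unfolding power2_eq_square sum_product by (intro sum.cong) (simp_all add: e_def)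
  moreover have "int v div 2 = int n" using v(2) by simp
  ultimately have "(if even n then int k - 2 else int k) = (\<Sum>x\<in>X. e x)\<^sup>2"
    by (cases "even n") (simp_all add: e_def)
  then show ?thesis unfolding is_nth_power_def by blast
qed

lemma modular_golomb_ruler_sum_two_squares:
  assumes mgr: "modular_golomb_ruler v k X" and v: "v = k\<^sup>2 - k + 2" "v mod 8 = 4"
  shows "\<exists>a b :: int. int k = a\<^sup>2 + b\<^sup>2"
proof -
  (* c d is the real part of i^d, and c (d - 1) its imaginary part *)
  define c where "c d = (if d mod 4 = 0 then 1 else if d mod 4 = 2 then - 1 else 0 :: int)" for d :: int
  have c_diff: "c (y - x) = c x * c y + c (x - 1) * c (y - 1)" for x y
  proof -
    have "x mod 4 \<in> {0, 1, 2, 3}" "y mod 4 \<in> {0, 1, 2, 3}" by auto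
    moreover have "(y - x) mod 4 = (y mod 4 - x mod 4) mod 4" "(x - 1) mod 4 = (x mod 4 - 1) mod 4"
      "(y - 1) mod 4 = (y mod 4 - 1) mod 4" by (simp_all add: mod_simps)
    ultimately show ?thesis unfolding c_def by (elim insertE emptyE) simp_all
  qed
  have "(\<Sum>d\<in>{0..<int 4}. c d) = 0"
  proof -
    have "{0..<int 4} = {0, 1, 2, 3}" by auto
    then show ?thesis by (simp add: c_def)
  qed
  moreover have "(\<Sum>x\<in>X. \<Sum>y\<in>X. c (y - x)) =
      of_nat k * c 0 + of_nat (v div 4) * (\<Sum>d\<in>{0..<int 4}. c d) - c 0 - c (int v div 2)"
  proof (rule modular_golomb_ruler_double_sum[OF mgr v(1)])
    show "4 dvd v" using v(2) by presburger
  qed (simp add: c_def)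
  moreover have "(\<Sum>x\<in>X. \<Sum>y\<in>X. c (y - x)) = (\<Sum>x\<in>X. c x)\<^sup>2 + (\<Sum>x\<in>X. c (x - 1))\<^sup>2"
    unfolding power2_eq_square sum_product sum.distrib[symmetric]
    by (intro sum.cong refl c_diff)
  moreover have "int v div 2 mod 4 = 2" using v(2) by presburger
  ultimately have "int k = (\<Sum>x\<in>X. c x)\<^sup>2 + (\<Sum>x\<in>X. c (x - 1))\<^sup>2" by (simp add: c_def)
  then show ?thesis by blast
qed

text \<open>
  The characters of order dividing \<open>q\<close> are trivial at the missing difference \<open>n\<close>, so the image \<open>A\<close> of the ruler
  has squared absolute value \<open>k - 2\<close> modulo the all-ones polynomial.
\<close>

lemma modular_golomb_ruler_even_multiplicity:
  assumes mgr: "modular_golomb_ruler v k X" and v: "v = k\<^sup>2 - k + 2" "v = 2 * n"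
    and p: "prime p" and q: "q > 1" "q dvd n" and j: "j > 0" "[p ^ j = q - 1] (mod q)"
  shows "even (multiplicity p (k - 2))"
proof -
  let ?X = "[:0, 1:] :: int poly"
  (* the image of the ruler in the group ring of the cyclic group of order q *)
  define A where "A = (\<Sum>x\<in>X. ?X ^ nat x)"
  define f where "f d = ?X ^ nat (d mod int q)" for d
  have X: "X \<subseteq> {0..<int v}" and k: "k \<ge> 3"
    using mgr unfolding modular_golomb_ruler_def by auto
  have A': "A \<circ>\<^sub>p ?X ^ (q - 1) = (\<Sum>x\<in>X. ?X ^ ((q - 1) * nat x))"
    unfolding A_def by (simp add: pcompose_sum pcompose_power pcompose_pCons power_mult)
  have prod: "A * A \<circ>\<^sub>p ?X ^ (q - 1) = (\<Sum>x\<in>X. \<Sum>y\<in>X. ?X ^ ((q - 1) * nat x + nat y))"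
    unfolding mult.commute[of A] A' unfolding A_def sum_product power_add ..
  have "(\<Sum>x\<in>X. \<Sum>y\<in>X. f (y - x)) =
      of_nat k * f 0 + of_nat (v div q) * (\<Sum>d\<in>{0..<int q}. f d) - f 0 - f (int v div 2)"
    using v(2) q(2) by (intro modular_golomb_ruler_double_sum[OF mgr v(1)]) (simp_all add: f_def)
  moreover have "f (int v div 2) = 1" "f 0 = 1" using v(2) q(2) by (auto simp: f_def)
  moreover have "(\<Sum>d\<in>{0..<int q}. f d) = all_ones_poly q"
  proof -
    have "{0..<int q} = int ` {..<q}" by (simp add: image_int_atLeastLessThan atLeast0LessThan[symmetric])
    then show ?thesis by (simp add: sum.reindex f_def all_ones_poly_def)
  qed
  ultimately have sum_f: "(\<Sum>x\<in>X. \<Sum>y\<in>X. f (y - x)) = of_nat (k - 2) + of_nat (v div q) * all_ones_poly q"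
    using k by (simp add: of_nat_diff)
  have int_q: "int (q - 1) = int q - 1" using q(1) by simp
  have "all_ones_poly q dvd (\<Sum>x\<in>X. \<Sum>y\<in>X. ?X ^ ((q - 1) * nat x + nat y) - f (y - x))"
  proof (intro dvd_sum)
    fix x y assume "x \<in> X" "y \<in> X"
    then have xy: "x \<ge> 0" "y \<ge> 0" using X by auto
    have "int ((q - 1) * nat x + nat y) = (y - x) + int q * x"
      using xy int_q unfolding of_nat_add of_nat_mult by (simp add: algebra_simps)
    then have "int ((q - 1) * nat x + nat y) mod int q = (y - x) mod int q" by simp
    then have "[int ((q - 1) * nat x + nat y) = int (nat ((y - x) mod int q))] (mod int q)"
      using q(1) by (simp add: cong_def)
    then show "all_ones_poly q dvd ?X ^ ((q - 1) * nat x + nat y) - f (y - x)"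
      unfolding f_def cong_int_iff by (rule all_ones_dvd_power_diff)
  qed
  then have "all_ones_poly q dvd A * A \<circ>\<^sub>p ?X ^ (q - 1) -
      (of_nat (k - 2) + of_nat (v div q) * all_ones_poly q)"
    unfolding prod sum_f[symmetric] by (simp only: sum_subtractf)
  then have "all_ones_poly q dvd (A * A \<circ>\<^sub>p ?X ^ (q - 1) -
      (of_nat (k - 2) + of_nat (v div q) * all_ones_poly q)) + of_nat (v div q) * all_ones_poly q"
    by (rule dvd_add) simp
  then have "all_ones_poly q dvd A * A \<circ>\<^sub>p ?X ^ (q - 1) - of_nat (k - 2)"
    by (simp only: diff_diff_eq[symmetric] diff_add_cancel)
  moreover have "k - 2 > 0" using k by simp
  ultimately show ?thesis using self_conjugate_even_multiplicity[OF p j(1) q(1) j(2)] by blast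
qed

section \<open>The necessary conditions\<close>

theorem corollary3p4:
  fixes k :: nat
  assumes "k \<ge> 3"
    and "\<exists>X. modular_golomb_ruler (k\<^sup>2 - k + 2) k X"
  shows "\<not> [k = 7] (mod 8) \<and>
    ([k = 2] (mod 8) \<longrightarrow>
      is_square (int k - 2) \<and> (\<exists>a b :: int. int k = a\<^sup>2 + b\<^sup>2)) \<and>
    ([k = 3] (mod 8) \<or> [k = 6] (mod 8) \<longrightarrow> is_square (int k - 2)) \<and>
    ([k = 0] (mod 8) \<or> [k = 1] (mod 8) \<longrightarrow>
      is_square (int k) \<and>
      (\<exists>x y z :: int. (x, y, z) \<noteq> (0, 0, 0) \<and> (int k - 2) * x\<^sup>2 + 2 * y\<^sup>2 = z\<^sup>2)) \<and>
    ([k = 4] (mod 8) \<or> [k = 5] (mod 8) \<longrightarrow>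
      is_square (int k) \<and>
      (\<exists>x y z :: int. (x, y, z) \<noteq> (0, 0, 0) \<and> (int k - 2) * x\<^sup>2 - 2 * y\<^sup>2 = z\<^sup>2))"
proof -
  define v where "v = k\<^sup>2 - k + 2"
  obtain X where mgr: "modular_golomb_ruler v k X" using assms(2) v_def by blast
  have kk: "k \<le> k\<^sup>2" by (simp add: power2_eq_square)
  have vk: "v + k = k\<^sup>2 + 2" using kk by (simp add: v_def)
  have "even (k\<^sup>2 + k)" by simp
  then have "even v" using vk by presburger
  then obtain n where n: "v = 2 * n" by (elim evenE)
  have v_mod: "int v mod 8 = (r\<^sup>2 - r + 2) mod 8" if "k mod 8 = nat r" "r \<ge> 0" for r
  proof -
    have "int (k mod 8) = r" using that by simp
    then have "int k mod 8 = r mod 8" by (simp add: zmod_int)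
    then have "[int k = r] (mod 8)" by (simp add: cong_def)
    then have "[(int k)\<^sup>2 - int k + 2 = r\<^sup>2 - r + 2] (mod 8)"
      by (intro cong_add cong_diff cong_pow cong_refl)
    moreover have "int v + int k = (int k)\<^sup>2 + 2" using arg_cong[OF vk, of int] by simp
    then have "int v = (int k)\<^sup>2 - int k + 2" by simp
    ultimately show ?thesis by (simp add: cong_def)
  qed
  note square = modular_golomb_ruler_parity_sum[OF mgr v_def n]
  have item1: "k mod 8 \<noteq> 7"
  proof
    assume "k mod 8 = 7"
    then have "int v mod 8 = 4" using v_mod[of 7] by simp
    then have "v mod 8 = 4" by presburger
    then obtain a b :: int where ab: "int k = a\<^sup>2 + b\<^sup>2"
      using modular_golomb_ruler_sum_two_squares[OF mgr v_def] by blast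
    have sq: "c\<^sup>2 mod 4 = 0 \<or> c\<^sup>2 mod 4 = 1" for c :: int
    proof (cases "even c")
      case True
      then show ?thesis by (auto simp: power2_eq_square elim!: evenE)
    next
      case False
      then obtain d where "c = 2 * d + 1" by (elim oddE)
      then have "c\<^sup>2 = 4 * (d * d + d) + 1" by (simp add: power2_eq_square algebra_simps)
      then show ?thesis by presburger
    qed
    have "int k mod 4 = 3" using \<open>k mod 8 = 7\<close> by presburger
    then show False using sq[of a] sq[of b] ab by presburger
  qed
  have item2: "is_square (int k - 2) \<and> (\<exists>a b :: int. int k = a\<^sup>2 + b\<^sup>2)" if "k mod 8 = 2"
  proof
    have v8: "v mod 8 = 4" using v_mod[of 2] that by simp presburger
    then have "even n" using n by presburger
    then show "is_square (int k - 2)" using square by simp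
    show "\<exists>a b :: int. int k = a\<^sup>2 + b\<^sup>2"
      by (rule modular_golomb_ruler_sum_two_squares[OF mgr v_def v8])
  qed
  have item3: "is_square (int k - 2)" if "k mod 8 = 3 \<or> k mod 8 = 6"
  proof -
    have "int v mod 8 = 0" using that v_mod[of 3] v_mod[of 6] by auto
    then have "even n" using n by presburger
    then show ?thesis using square by simp
  qed
  have item4: "is_square (int k) \<and>
      (\<exists>x y z :: int. (x, y, z) \<noteq> (0, 0, 0) \<and> (int k - 2) * x\<^sup>2 + 2 * y\<^sup>2 = z\<^sup>2)"
    if "k mod 8 = 0 \<or> k mod 8 = 1"
  proof -
    have "int v mod 8 = 2" using that v_mod[of 0] v_mod[of 1] by auto
    then have "odd n" using n by presburger
    then have sq: "is_square (int k)" using square by simp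
    then obtain a where "int k = a\<^sup>2" by (auto simp: is_nth_power_def)
    (* k - 2 and 2 add up to the square k *)
    then have "(1::int, 1::int, a) \<noteq> (0, 0, 0) \<and> (int k - 2) * 1\<^sup>2 + 2 * 1\<^sup>2 = a\<^sup>2" by simp
    then show ?thesis using sq by blast
  qed
  have item5: "is_square (int k) \<and>
      (\<exists>x y z :: int. (x, y, z) \<noteq> (0, 0, 0) \<and> (int k - 2) * x\<^sup>2 - 2 * y\<^sup>2 = z\<^sup>2)"
    if "k mod 8 = 4 \<or> k mod 8 = 5"
  proof -
    have "int v mod 8 = 6" using that v_mod[of 4] v_mod[of 5] by auto
    then have n4: "n mod 4 = 3" using n by presburger
    then have "odd n" by presburger
    then have sq: "is_square (int k)" using square by simp
    then obtain a :: int where "int k = a\<^sup>2" by (auto simp: is_nth_power_def)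
    moreover have "int (nat \<bar>a\<bar> ^ 2) = a\<^sup>2" by simp
    ultimately have a: "k = (nat \<bar>a\<bar>)\<^sup>2" by (simp only: of_nat_eq_iff)
    have "square_plus_two_squares ((nat \<bar>a\<bar>)\<^sup>2 - 2)"
    proof (rule square_plus_two_squares_square_minus_2[where N = n])
      fix p q j :: nat
      assume "prime p" "prime q" "q dvd n" "j > 0" "[p ^ j = q - 1] (mod q)"
      then show "even (multiplicity p ((nat \<bar>a\<bar>)\<^sup>2 - 2))"
        unfolding a[symmetric]
        by (intro modular_golomb_ruler_even_multiplicity[OF mgr v_def n]) (auto simp: prime_gt_Suc_0_nat)
    qed (unfold a[symmetric], use assms(1) n v_def n4 in simp_all)
    then obtain x y :: int where "int (k - 2) = x\<^sup>2 + 2 * y\<^sup>2"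
      unfolding a[symmetric] square_plus_two_squares_def by blast
    then have "(1::int, y, x) \<noteq> (0, 0, 0) \<and> (int k - 2) * 1\<^sup>2 - 2 * y\<^sup>2 = x\<^sup>2"
      using assms(1) by (simp add: of_nat_diff)
    then show ?thesis using sq by blast
  qed
  show ?thesis unfolding cong_def using item1 item2 item3 item4 item5 by simp
qed

end
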